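(* Let $B$, $\Omega$ be the $N\times N$ matrices ($N=(h+1)K$) of the systems form $x=Bx+\Omega\varepsilon$ of a structural VARMA model satisfying the standing assumptions in the context, and let $\mathcal{G}(B,\Omega)$ be the induced graph. Fix a shock index $i\in\{1,\dots,K\}$, an outcome index $j\in\{1,\dots,N\}$ and a shock size $\xi\in\mathbb{R}$. Then: (i) For every collection of paths $P_{\varepsilon_i,x_j}\subseteq\mathcal{P}_{\varepsilon_i,x_j}$ there exists a potential outcomes assignment vector $\epsilon^{(j)}\in\{0,\xi\}^{\eta(j)}$ such that $\mathcal{Q}_\xi(P_{\varepsilon_i,x_j})=\mathcal{C}_{\varepsilon_i,x_j}(\epsilon^{(j)})$. (ii) For every potential outcomes assignment vector $\epsilon^{(j)}\in\{0,\xi\}^{\eta(j)}$ there exists a collection of paths $P_{\varepsilon_i,x_j}\subseteq\mathcal{P}_{\varepsilon_i,x_j}$ such that $\mathcal{C}_{\varepsilon_i,x_j}(\epsilon^{(j)})=\mathcal{Q}_\xi(P_{\varepsilon_i,x_j})$.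
   Context: Model. Let $K\ge1$, $\ell,q,h\ge0$ be integers. $y_t$ is a $K$-dimensional stationary process satisfying the structural VARMA equation $A_0y_t=\sum_{i=1}^{\ell}A_iy_{t-i}+\sum_{j=1}^{q}\Psi_j\varepsilon_{t-j}+\varepsilon_t$ with real $K\times K$ matrices. Standing assumptions: $E[\varepsilon_t]=0$, $E[\varepsilon_t\varepsilon_t']=I$, $E[\varepsilon_t\varepsilon_{t-r}']=O$ for all $r\ge1$; $A_0$ is non-singular. $T$ is a fixed $K\times K$ permutation matrix (the transmission matrix). Put $y_t^*=Ty_t$, $A_i^*=A_iT'$ for $i\ge0$, with $A_i^*=O$ for $i>\ell$ and $\Psi_j=O$ for $j>q$. Let $A_0^*=QL$ be the unique QL-decomposition with $Q$ orthogonal and $L$ lower-triangular with positive diagonal, and let $D=\mathrm{diag}(L)^{-1}$ be the inverse of the diagonal part of $L$. Systems form. Let $N=(h+1)K$, $x=(y_t^{*\prime},\dots,y_{t+h}^{*\prime})'$, $\varepsilon=(\varepsilon_t',\dots,\varepsilon_{t+h}')'$. $B$ and $\Omega$ are $N\times N$ matrices made of $K\times K$ blocks indexed by $a,b\in\{0,\dots,h\}$: for $a=b$ the block of $B$ is $I-DL$ and that of $\Omega$ is $DQ'$; for $a>b$ the block of $B$ is $DQ'A^*_{a-b}$ and that of $\Omega$ is $DQ'\Psi_{a-b}$; for $a<b$ both are zero. So $B$ is strictly lower-triangular. The system is $x=Bx+\Omega\varepsilon$ (variables and shocks dated before $t$, being unaffected by shocks at $t$, are dropped). Graph. $\mathcal{G}(B,\Omega)$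 is the directed acyclic graph with nodes $\varepsilon_1,\dots,\varepsilon_K$ (the shocks at time $t$) and $x_1,\dots,x_N$. There is an edge $x_m\to x_n$ iff $B_{n,m}\ne0$, with path coefficient $\omega_{x_m,x_n}=B_{n,m}$, and an edge $\varepsilon_i\to x_n$ iff $\Omega_{n,i}\neq0$, with path coefficient $\omega_{\varepsilon_i,x_n}=\Omega_{n,i}$. $\mathcal{P}_{u,v}$ is the set of all directed paths from node $u$ to node $v$. For shock size $\xi$, the path-specific effect of a path $p$ is $\mathcal{Q}_\xi(p)=\xi\prod_{(u\to v)\in p}\omega_{u,v}$, and the total path-specific effect of a collection $P$ of paths is $\mathcal{Q}_\xi(P)=\sum_{p\in P}\mathcal{Q}_\xi(p)$. Potential outcomes. Fix the shock $\varepsilon_i$. Let $\eta(j)=2^{j-1}$ and $H(j)=2^j-1$ (so $H(0)=0$). A potential outcomes assignment vector for $x_j$ is a vector $\epsilon^{(j)}=(\epsilon_1,\dots,\epsilon_{\eta(j)})$ with all entries in $\{0,\xi\}$. For $k<j$ let $\epsilon^{(j\cdot k)}=(\epsilon^{(j)}_{H(k-1)+1},\dots,\epsilon^{(j)}_{H(k)})$, a vector of length $\eta(k)$. The potential outcome $x_j^*(\epsilon^{(j)})$ is the value of $x_j$ when each nested dependency chain from $x_j$ back to $\varepsilon_i$ experiences its own realisation of $\varepsilon_i$; recursively, $$x_j^*(\epsilon^{(j)})=\sum_{k=1}^{j-1}B_{j,k}\,x_k^*(\epsilon^{(j\cdot k)})+\Omega_{j,i}\,\epsilon^{(j)}_{\eta(j)}+\sum_{m\ne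 i}\Omega_{j,m}\varepsilon_m .$$ The causal effect is $\mathcal{C}_{\varepsilon_i,x_j}(\epsilon^{(j)})=E[x_j^*(\epsilon^{(j)})-x_j^*(0)]$, with $0$ the zero vector of length $\eta(j)$. *)

theory Defs
  imports
    "HOL-Probability.Probability"
    "HOL-Combinatorics.Permutations"
    "Jordan_Normal_Form.Matrix"
    "Graph_Theory.Arc_Walk"
begin

no_notation vec_nth (infixl \<open>$\<close> 90)

text \<open>
  All indices (coordinates, shocks, outcomes, matrix entries) start at 0, as is usual for
  matrices and lists; index \<open>k\<close> below is index \<open>k + 1\<close> of a numbering that starts at 1.
  Coordinate \<open>r\<close> of a vector stacked from blocks of length \<open>K\<close> is coordinate \<open>r mod K\<close> of
  block \<open>r div K\<close>.
\<close>

section \<open>The structural VARMA model\<close>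

text \<open>Covariance stationarity of a process of \<open>K\<close>-dimensional random vectors.\<close>

definition stationary_process :: "'w measure \<Rightarrow> nat \<Rightarrow> (int \<Rightarrow> 'w \<Rightarrow> real vec) \<Rightarrow> bool" where
  "stationary_process M K y \<longleftrightarrow>
     (\<forall>t. \<forall>\<omega>\<in>space M. y t \<omega> \<in> carrier_vec K) \<and>
     (\<forall>t. \<forall>k<K. (\<lambda>\<omega>. y t \<omega> $ k) \<in> borel_measurable M \<and> integrable M (\<lambda>\<omega>. (y t \<omega> $ k)\<^sup>2)) \<and>
     (\<forall>s t. \<forall>k<K. (\<integral>\<omega>. y s \<omega> $ k \<partial>M) = (\<integral>\<omega>. y t \<omega> $ k \<partial>M)) \<and>
     (\<forall>s t r. \<forall>k<K. \<forall>m<K.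
        (\<integral>\<omega>. y (s + r) \<omega> $ k * y s \<omega> $ m \<partial>M) = (\<integral>\<omega>. y (t + r) \<omega> $ k * y t \<omega> $ m \<partial>M))"

text \<open>Mean zero, identity covariance matrix, and no correlation across time.\<close>

definition white_noise :: "'w measure \<Rightarrow> nat \<Rightarrow> (int \<Rightarrow> 'w \<Rightarrow> real vec) \<Rightarrow> bool" where
  "white_noise M K \<epsilon> \<longleftrightarrow>
     (\<forall>t. \<forall>\<omega>\<in>space M. \<epsilon> t \<omega> \<in> carrier_vec K) \<and>
     (\<forall>t. \<forall>k<K. (\<lambda>\<omega>. \<epsilon> t \<omega> $ k) \<in> borel_measurable M \<and> integrable M (\<lambda>\<omega>. (\<epsilon> t \<omega> $ k)\<^sup>2)) \<and>
     (\<forall>t. \<forall>k<K. (\<integral>\<omega>. \<epsilon> t \<omega> $ k \<partial>M) = 0) \<and>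
     (\<forall>t. \<forall>k<K. \<forall>m<K. (\<integral>\<omega>. \<epsilon> t \<omega> $ k * \<epsilon> t \<omega> $ m \<partial>M) = (if k = m then 1 else 0)) \<and>
     (\<forall>t. \<forall>r\<ge>1. \<forall>k<K. \<forall>m<K. (\<integral>\<omega>. \<epsilon> t \<omega> $ k * \<epsilon> (t - r) \<omega> $ m \<partial>M) = 0)"

definition permutation_matrix :: "nat \<Rightarrow> real mat \<Rightarrow> bool" where
  "permutation_matrix K T \<longleftrightarrow>
     (\<exists>\<pi>. \<pi> permutes {..<K} \<and> T = Matrix.mat K K (\<lambda>(r, c). if c = \<pi> r then 1 else 0))"

locale structural_varma = prob_space M
  for M :: "'w measure" +
  fixes K l q :: nat
    and A \<Psi> :: "nat \<Rightarrow> real mat"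
    and y \<epsilon> :: "int \<Rightarrow> 'w \<Rightarrow> real vec"
  assumes K_pos: "K \<ge> 1"
    and A_carrier: "i \<le> l \<Longrightarrow> A i \<in> carrier_mat K K"
    and Psi_carrier: "1 \<le> j \<Longrightarrow> j \<le> q \<Longrightarrow> \<Psi> j \<in> carrier_mat K K"
    and A0_nonsingular: "invertible_mat (A 0)"
    and y_stationary: "stationary_process M K y"
    and eps_white_noise: "white_noise M K \<epsilon>"
    and varma_equation: "AE \<omega> in M. \<forall>k<K.
          (A 0 *\<^sub>v y t \<omega>) $ k
            = (\<Sum>i=1..l. (A i *\<^sub>v y (t - int i) \<omega>) $ k)
            + (\<Sum>j=1..q. (\<Psi> j *\<^sub>v \<epsilon> (t - int j) \<omega>) $ k) + \<epsilon> t \<omega> $ k"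

section \<open>The systems form\<close>

definition A_star :: "nat \<Rightarrow> nat \<Rightarrow> (nat \<Rightarrow> real mat) \<Rightarrow> real mat \<Rightarrow> nat \<Rightarrow> real mat" where
  "A_star K l A T i = (if i \<le> l then A i * transpose_mat T else 0\<^sub>m K K)"

definition Psi_ext :: "nat \<Rightarrow> nat \<Rightarrow> (nat \<Rightarrow> real mat) \<Rightarrow> nat \<Rightarrow> real mat" where
  "Psi_ext K q \<Psi> j = (if j \<le> q then \<Psi> j else 0\<^sub>m K K)"

text \<open>The library's \<^const>\<open>orthogonal_mat\<close> does not require normalised columns.\<close>

definition QL_decomposition :: "nat \<Rightarrow> real mat \<Rightarrow> real mat \<Rightarrow> real mat \<Rightarrow> bool" where
  "QL_decomposition K X Q L \<longleftrightarrow>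
     Q \<in> carrier_mat K K \<and> L \<in> carrier_mat K K \<and> X = Q * L \<and>
     transpose_mat Q * Q = 1\<^sub>m K \<and> Q * transpose_mat Q = 1\<^sub>m K \<and>
     (\<forall>r<K. \<forall>c<K. r < c \<longrightarrow> L $$ (r, c) = 0) \<and> (\<forall>r<K. L $$ (r, r) > 0)"

definition inv_diag :: "nat \<Rightarrow> real mat \<Rightarrow> real mat" where
  "inv_diag K L = mat_diag K (\<lambda>r. inverse (L $$ (r, r)))"

definition block_matrix :: "nat \<Rightarrow> nat \<Rightarrow> (nat \<Rightarrow> nat \<Rightarrow> real mat) \<Rightarrow> real mat" where
  "block_matrix K h F = Matrix.mat ((h + 1) * K) ((h + 1) * K)
     (\<lambda>(r, c). F (r div K) (c div K) $$ (r mod K, c mod K))"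

definition systems_B ::
  "nat \<Rightarrow> nat \<Rightarrow> nat \<Rightarrow> (nat \<Rightarrow> real mat) \<Rightarrow> real mat \<Rightarrow> real mat \<Rightarrow> real mat \<Rightarrow> real mat" where
  "systems_B K l h A T Q L = block_matrix K h (\<lambda>a b.
     if a = b then 1\<^sub>m K - inv_diag K L * L
     else if a > b then inv_diag K L * transpose_mat Q * A_star K l A T (a - b)
     else 0\<^sub>m K K)"

definition systems_Omega ::
  "nat \<Rightarrow> nat \<Rightarrow> nat \<Rightarrow> (nat \<Rightarrow> real mat) \<Rightarrow> real mat \<Rightarrow> real mat \<Rightarrow> real mat" where
  "systems_Omega K q h \<Psi> Q L = block_matrix K h (\<lambda>a b.
     if a = b then inv_diag K L * transpose_mat Q
     else if a > b then inv_diag K L * transpose_mat Q * Psi_ext K q \<Psi> (a - b)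
     else 0\<^sub>m K K)"

definition stacked :: "nat \<Rightarrow> nat \<Rightarrow> (int \<Rightarrow> 'w \<Rightarrow> real vec) \<Rightarrow> int \<Rightarrow> 'w \<Rightarrow> real vec" where
  "stacked K h z t \<omega> = Matrix.vec ((h + 1) * K) (\<lambda>m. z (t + int (m div K)) \<omega> $ (m mod K))"

section \<open>The induced graph and path-specific effects\<close>

datatype node = Shock nat | Var nat

definition induced_graph :: "nat \<Rightarrow> real mat \<Rightarrow> real mat \<Rightarrow> (node, node \<times> node) pre_digraph" where
  "induced_graph K B \<Omega> = \<lparr>
     verts = Shock ` {..<K} \<union> Var ` {..<dim_row B},
     arcs = {(Var m, Var n) |m n. m < dim_row B \<and> n < dim_row B \<and> B $$ (n, m) \<noteq> 0}
          \<union> {(Shock i, Var n) |i n. i < K \<and> n < dim_row B \<and> \<Omega> $$ (n, i) \<noteq> 0},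
     tail = fst, head = snd\<rparr>"

text \<open>Path coefficients; the value 0 on pairs that are not arcs is irrelevant.\<close>

fun path_coefficient :: "real mat \<Rightarrow> real mat \<Rightarrow> node \<times> node \<Rightarrow> real" where
  "path_coefficient B \<Omega> (Var m, Var n) = B $$ (n, m)"
| "path_coefficient B \<Omega> (Shock i, Var n) = \<Omega> $$ (n, i)"
| "path_coefficient B \<Omega> (_, Shock _) = 0"

definition paths :: "(node, node \<times> node) pre_digraph \<Rightarrow> node \<Rightarrow> node \<Rightarrow> (node \<times> node) list set" where
  "paths G u v = {p. pre_digraph.apath G u p v}"

definition path_effect :: "real mat \<Rightarrow> real mat \<Rightarrow> real \<Rightarrow> (node \<times> node) list \<Rightarrow> real" where
  "path_effect B \<Omega> \<xi> p = \<xi> * prod_list (map (path_coefficient B \<Omega>) p)"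

definition total_path_effect :: "real mat \<Rightarrow> real mat \<Rightarrow> real \<Rightarrow> (node \<times> node) list set \<Rightarrow> real" where
  "total_path_effect B \<Omega> \<xi> P = (\<Sum>p\<in>P. path_effect B \<Omega> \<xi> p)"

section \<open>Potential outcomes\<close>

text \<open>
  With indices starting at 0, an assignment vector for outcome \<open>j\<close> has length \<open>2 ^ j\<close>, the
  subvector handed to \<open>k < j\<close> consists of the entries \<open>2 ^ k - 1, \<dots>, 2 ^ (k + 1) - 2\<close>, and the
  last entry \<open>2 ^ j - 1\<close> is the realisation of the shock entering outcome \<open>j\<close> directly.
\<close>

definition assignments :: "real \<Rightarrow> nat \<Rightarrow> real list set" where
  "assignments \<xi> j = {v. length v = 2 ^ j \<and> set v \<subseteq> {0, \<xi>}}"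

definition subassignment :: "nat \<Rightarrow> real list \<Rightarrow> real list" where
  "subassignment k v = take (2 ^ k) (drop (2 ^ k - 1) v)"

text \<open>\<open>e\<close> is the realisation of the stacked shock vector.\<close>

function potential_outcome ::
  "real mat \<Rightarrow> real mat \<Rightarrow> nat \<Rightarrow> real vec \<Rightarrow> nat \<Rightarrow> real list \<Rightarrow> real" where
  "potential_outcome B \<Omega> i e j v =
     (\<Sum>k<j. B $$ (j, k) * potential_outcome B \<Omega> i e k (subassignment k v))
     + \<Omega> $$ (j, i) * v ! (2 ^ j - 1)
     + (\<Sum>m\<in>{..<dim_col \<Omega>} - {i}. \<Omega> $$ (j, m) * e $ m)"
  by pat_completeness auto
termination
  by (relation "Wellfounded.measure (\<lambda>(B, \<Omega>, i, e, j, v). j)") auto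

declare potential_outcome.simps [simp del]

definition causal_effect ::
  "'w measure \<Rightarrow> real mat \<Rightarrow> real mat \<Rightarrow> nat \<Rightarrow> ('w \<Rightarrow> real vec) \<Rightarrow> nat \<Rightarrow> real list \<Rightarrow> real" where
  "causal_effect M B \<Omega> i e j v =
     (\<integral>\<omega>. potential_outcome B \<Omega> i (e \<omega>) j v
         - potential_outcome B \<Omega> i (e \<omega>) j (replicate (2 ^ j) 0) \<partial>M)"

end

theory Submission
  imports Defs
begin

text \<open>
  Subtracting the zero assignment cancels the other shocks, so the causal effect is deterministic
  and obeys the recursion \<open>C\<^sub>j(v) = (\<Sum>k<j. B\<^sub>j\<^sub>k C\<^sub>k(v\<^sub>k)) + \<Omega>\<^sub>j\<^sub>i v\<^sub>\<ast>\<close>, where the subvectors \<open>v\<^sub>k\<close> and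
  the last entry \<open>v\<^sub>\<ast>\<close> can be chosen independently of each other. Since \<open>B\<close> is strictly lower
  triangular, a path into \<open>Var j\<close> is either the direct arc from the shock or a path into some
  \<open>Var k\<close> with \<open>k < j\<close> followed by one arc, so that total path effects obey the same recursion, with
  the set of paths arriving through \<open>Var k\<close> in the role of \<open>v\<^sub>k\<close>. Both claims follow by induction
  on \<open>j\<close>.
\<close>

section \<open>Causal effects\<close>

lemma subassignment_replicate:
  assumes "k < j"
  shows "subassignment k (replicate (2 ^ j) c) = replicate (2 ^ k) c"
proof -
  \<comment> \<open>The window for \<open>k\<close> ends before position
    \<open>2 ^ Suc k - 1\<close>, so this bound keeps it inside the vector.\<close>
  have "(2::nat) ^ Suc k \<le> 2 ^ j"
    using assms by (intro power_increasing) auto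
  then show ?thesis
    by (simp add: subassignment_def min_def)
qed

lemma subassignment_in_assignments:
  assumes "v \<in> assignments \<xi> j" "k < j"
  shows "subassignment k v \<in> assignments \<xi> k"
proof -
  have "(2::nat) ^ Suc k \<le> 2 ^ j"
    using assms by (intro power_increasing) auto
  moreover have "set (subassignment k v) \<subseteq> set v"
    unfolding subassignment_def using set_take_subset set_drop_subset by fastforce
  ultimately show ?thesis
    using assms(1) by (auto simp: assignments_def subassignment_def)
qed

lemma assignment_last_in:
  assumes "v \<in> assignments \<xi> j"
  shows "v ! (2 ^ j - 1) \<in> {0, \<xi>}"
proof -
  have "v ! (2 ^ j - 1) \<in> set v"
    using assms by (simp add: assignments_def)
  then show ?thesis
    using assms unfolding assignments_def by blast
qed

text \<open>Since \<open>1 + 2 + ... + 2 ^ (k - 1) = 2 ^ k - 1\<close>, the blocks before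
  \<open>w k\<close> fill exactly the offset that \<open>subassignment k\<close> skips.\<close>

lemma concat_blocks:
  assumes "\<And>k. k < j \<Longrightarrow> length (w k) = 2 ^ k"
  shows "length (concat (map w [0..<j])) = 2 ^ j - 1"
    and "k < j \<Longrightarrow> subassignment k (concat (map w [0..<j]) @ xs) = w k"
  using assms
proof (induction j arbitrary: xs)
  case (Suc j)
  {
    case 1
    have "length (concat (map w [0..<j])) = 2 ^ j - 1" "length (w j) = 2 ^ j"
      using Suc.IH(1) 1 by auto
    then show ?case
      by simp
  next
    case 2
    have len: "length (concat (map w [0..<j])) = 2 ^ j - 1" "length (w j) = 2 ^ j"
      using Suc.IH(1) 2 by auto
    show ?case
    proof (cases "k = j")
      case True
      then show ?thesis
        using len by (simp add: subassignment_def)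
    next
      case False
      then show ?thesis
        \<comment> \<open>Block \<open>w j\<close> is absorbed into the suffix, which is why
          \<open>xs\<close> is arbitrary in the induction.\<close>
        using Suc.IH(2)[of "w j @ xs"] 2 by auto
    qed
  }
qed auto

text \<open>The windows for \<open>k < j\<close> and the final position partition the vector, so
  concatenating the parts realises any choice of them.\<close>

lemma assignment_of_parts:
  assumes "\<And>k. k < j \<Longrightarrow> w k \<in> assignments \<xi> k" "c \<in> {0, \<xi>}"
  obtains v where "v \<in> assignments \<xi> j" "\<And>k. k < j \<Longrightarrow> subassignment k v = w k"
    "v ! (2 ^ j - 1) = c"
proof
  have w: "length (w k) = 2 ^ k" "set (w k) \<subseteq> {0, \<xi>}" if "k < j" for k
    using assms(1)[OF that] by (auto simp: assignments_def)
  let ?v = "concat (map w [0..<j]) @ [c]"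
  have len: "length (concat (map w [0..<j])) = 2 ^ j - 1"
    by (rule concat_blocks(1)) (rule w(1))
  then show "?v ! (2 ^ j - 1) = c"
    by (metis nth_append_length)
  show "?v \<in> assignments \<xi> j"
    using len w(2) assms(2) by (fastforce simp: assignments_def)
  show "subassignment k ?v = w k" if "k < j" for k
    by (rule concat_blocks(2)) (use that w(1) in auto)
qed

text \<open>The terms in \<open>e\<close> enter additively and do not depend on \<open>v\<close>, so
  the difference cancels them, just as setting \<open>e\<close> to zero does.\<close>

lemma potential_outcome_superposition:
  "potential_outcome B \<Omega> i e j v - potential_outcome B \<Omega> i e j (replicate (2 ^ j) 0)
     = potential_outcome B \<Omega> i (0\<^sub>v (dim_col \<Omega>)) j v"
proof (induction j arbitrary: v rule: less_induct)
  case (less j)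
  let ?p = "potential_outcome B \<Omega> i"
  have "(\<Sum>k<j. B $$ (j, k) * ?p e k (subassignment k v))
      - (\<Sum>k<j. B $$ (j, k) * ?p e k (subassignment k (replicate (2 ^ j) 0)))
      = (\<Sum>k<j. B $$ (j, k) * ?p (0\<^sub>v (dim_col \<Omega>)) k (subassignment k v))"
    unfolding sum_subtractf[symmetric]
    by (intro sum.cong refl)
       (simp add: subassignment_replicate less.IH[symmetric] right_diff_distrib)
  then show ?case
    by (subst (1 2 3) potential_outcome.simps) simp
qed

text \<open>By superposition the integrand is constant on the sample space, which has total mass
  1.\<close>

lemma (in prob_space) causal_effect_recursion:
  "causal_effect M B \<Omega> i e j v =
     (\<Sum>k<j. B $$ (j, k) * causal_effect M B \<Omega> i e k (subassignment k v))
     + \<Omega> $$ (j, i) * v ! (2 ^ j - 1)"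
proof -
  have "causal_effect M B \<Omega> i e k u = potential_outcome B \<Omega> i (0\<^sub>v (dim_col \<Omega>)) k u" for k u
    unfolding causal_effect_def potential_outcome_superposition by (simp add: prob_space)
  then show ?thesis
    by (simp only:) (subst potential_outcome.simps, simp)
qed

section \<open>Paths in the induced graph\<close>

lemma fin_digraph_induced_graph: "fin_digraph (induced_graph K B \<Omega>)"
proof (unfold_locales)
  let ?G = "induced_graph K B \<Omega>"
  show fin: "finite (verts ?G)"
    by (simp add: induced_graph_def)
  have "arcs ?G \<subseteq> verts ?G \<times> verts ?G"
    by (auto simp: induced_graph_def)
  then show "finite (arcs ?G)"
    using fin finite_subset by blast
qed (auto simp: induced_graph_def)

text \<open>The property of the systems form on which the path arguments rest: every arc between
  variables raises the index.\<close>

locale strictly_lower_system =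
  fixes K :: nat and B \<Omega> :: "real mat"
  assumes B_strictly_lower: "n < dim_row B \<Longrightarrow> n \<le> m \<Longrightarrow> m < dim_row B \<Longrightarrow> B $$ (n, m) = 0"
begin

abbreviation G :: "(node, node \<times> node) pre_digraph" where
  "G \<equiv> induced_graph K B \<Omega>"

sublocale fin_digraph G
  by (rule fin_digraph_induced_graph)

lemma tail_head_G [simp]: "tail G = fst" "head G = snd"
  by (simp_all add: induced_graph_def)

lemma finite_paths: "finite (paths G u v)"
  unfolding paths_def by (rule apaths_finite)

lemma arc_cases:
  assumes "e \<in> arcs G"
  obtains (var) m n where "e = (Var m, Var n)" "m < n" "n < dim_row B" "B $$ (n, m) \<noteq> 0"
  | (shock) i n where "e = (Shock i, Var n)" "i < K" "n < dim_row B" "\<Omega> $$ (n, i) \<noteq> 0"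
  using assms B_strictly_lower by (auto simp: induced_graph_def) (metis not_le)

text \<open>Indices rise along arcs between variables. The bound keeps vertices distinct when an arc
  into \<open>Var j\<close> is appended to a path ending at an earlier variable.\<close>

lemma awalk_verts_upto:
  assumes "awalk u p (Var j)"
  shows "set (awalk_verts u p) \<subseteq> range Shock \<union> Var ` {..j}"
  using assms
proof (induction p arbitrary: u)
  case (Cons e p)
  then have e: "e \<in> arcs G" "u = fst e" "awalk (snd e) p (Var j)"
    by (auto simp: awalk_Cons_iff)
  then have "snd e \<in> range Shock \<union> Var ` {..j}"
    using Cons.IH hd_in_awalk_verts(1) by blast
  with e show ?case
    using Cons.IH[OF e(3)] by (cases rule: arc_cases[OF e(1)]) auto
qed (auto simp: awalk_Nil_iff)

lemma snoc_in_paths_iff: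
  assumes "i < K" "j < dim_row B"
  shows "p @ [e] \<in> paths G (Shock i) (Var j) \<longleftrightarrow>
    p = [] \<and> e = (Shock i, Var j) \<and> \<Omega> $$ (j, i) \<noteq> 0 \<or>
    (\<exists>k<j. e = (Var k, Var j) \<and> B $$ (j, k) \<noteq> 0 \<and> p \<in> paths G (Shock i) (Var k))"
    (is "?L \<longleftrightarrow> ?direct \<or> ?indirect")
proof
  assume ?L
  then have p: "apath (Shock i) p (fst e)" and e: "e \<in> arcs G" "snd e = Var j"
    by (auto simp: paths_def apath_append_iff apath_Cons_iff apath_Nil_iff)
  from e(1) show "?direct \<or> ?indirect"
  proof (cases rule: arc_cases)
    case (var m n)
    then show ?thesis
      using p e by (auto simp: paths_def)
  next
    case (shock i' n)
    \<comment> \<open>No arc enters a shock, so a path ending at \<open>Shock i'\<close> has no last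
      arc.\<close>
    have "p = []"
    proof (cases p rule: rev_cases)
      case (snoc p' e')
      then have "e' \<in> arcs G" "snd e' = Shock i'"
        using p shock by (auto simp: apath_append_iff apath_Cons_iff apath_Nil_iff)
      then show ?thesis
        by (auto elim: arc_cases)
    qed
    then show ?thesis
      using p e shock by (auto simp: apath_Nil_iff)
  qed
next
  have verts: "Shock i \<in> verts G" "Var j \<in> verts G"
    using assms by (auto simp: induced_graph_def)
  assume "?direct \<or> ?indirect"
  then show ?L
  proof
    assume ?direct
    then show ?thesis
      using verts assms
      by (auto simp: paths_def apath_Cons_iff apath_Nil_iff) (auto simp: induced_graph_def)
  next
    assume ?indirect
    then obtain k where k: "k < j" "e = (Var k, Var j)" "B $$ (j, k) \<noteq> 0"
      and p: "apath (Shock i) p (Var k)"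
      by (auto simp: paths_def)
    from k assms have "e \<in> arcs G"
      by (auto simp: induced_graph_def)
    moreover have "Var j \<notin> set (awalk_verts (Shock i) p)"
      using awalk_verts_upto[OF awalkI_apath[OF p]] k(1) by auto
    moreover have "awlast (Shock i) p = Var k"
      using p by (auto simp: apath_def)
    ultimately show ?thesis
      using p k verts by (auto simp: paths_def apath_append_iff apath_Cons_iff apath_Nil_iff)
  qed
qed

lemma total_path_effect_recursion:
  assumes "i < K" "j < dim_row B" and P: "P \<subseteq> paths G (Shock i) (Var j)"
  shows "total_path_effect B \<Omega> \<xi> P =
    (\<Sum>k<j. B $$ (j, k) * total_path_effect B \<Omega> \<xi>
        {p \<in> paths G (Shock i) (Var k). p @ [(Var k, Var j)] \<in> P})
    + \<Omega> $$ (j, i) * (if [(Shock i, Var j)] \<in> P then \<xi> else 0)"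
proof -
  \<comment> \<open>Sort \<open>P\<close> by last arc: \<open>S k\<close> holds the paths whose last
    arc leaves \<open>Var k\<close>, \<open>R k\<close> the same paths without that arc,
    \<open>D\<close> the direct path if present. Different last arcs make the classes
    disjoint.\<close>
  define R where "R k = {p \<in> paths G (Shock i) (Var k). p @ [(Var k, Var j)] \<in> P}" for k
  define S where "S k = (\<lambda>p. p @ [(Var k, Var j)]) ` R k" for k
  define D where "D = P \<inter> {[(Shock i, Var j)]}"
  have fin: "finite (R k)" for k
    unfolding R_def using finite_paths by simp
  have eq: "P = (\<Union>k<j. S k) \<union> D"
  proof
    show "P \<subseteq> (\<Union>k<j. S k) \<union> D"
    proof
      fix p assume "p \<in> P"
      show "p \<in> (\<Union>k<j. S k) \<union> D"
      proof (cases p rule: rev_cases)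
        case Nil
        then show ?thesis
          using \<open>p \<in> P\<close> P by (auto simp: paths_def apath_Nil_iff)
      next
        case (snoc p' e)
        then have "p' @ [e] \<in> paths G (Shock i) (Var j)"
          using \<open>p \<in> P\<close> P by blast
        then show ?thesis
          unfolding snoc_in_paths_iff[OF assms(1,2)]
          using \<open>p \<in> P\<close> snoc by (auto simp: S_def R_def D_def)
      qed
    qed
  qed (auto simp: S_def R_def D_def)
  have "total_path_effect B \<Omega> \<xi> P =
    total_path_effect B \<Omega> \<xi> (\<Union>k<j. S k) + total_path_effect B \<Omega> \<xi> D"
    unfolding total_path_effect_def
    by (subst eq, rule sum.union_disjoint) (auto simp: fin S_def D_def)
  also have "total_path_effect B \<Omega> \<xi> (\<Union>k<j. S k) = (\<Sum>k<j. total_path_effect B \<Omega> \<xi> (S k))"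
    unfolding total_path_effect_def
    by (rule sum.UNION_disjoint) (use fin in \<open>auto simp: S_def\<close>)
  also have "\<dots> = (\<Sum>k<j. B $$ (j, k) * total_path_effect B \<Omega> \<xi> (R k))"
  proof (rule sum.cong[OF refl])
    fix k
    have "inj_on (\<lambda>p. p @ [(Var k, Var j)]) (R k)"
      by (auto simp: inj_on_def)
    then show "total_path_effect B \<Omega> \<xi> (S k) = B $$ (j, k) * total_path_effect B \<Omega> \<xi> (R k)"
      by (simp add: total_path_effect_def S_def sum.reindex path_effect_def
          sum_distrib_left mult_ac)
  qed
  also have "total_path_effect B \<Omega> \<xi> D = \<Omega> $$ (j, i) * (if [(Shock i, Var j)] \<in> P then \<xi> else 0)"
    by (auto simp: total_path_effect_def D_def path_effect_def)
  finally show ?thesis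
    unfolding R_def .
qed

section \<open>Equivalence of path effects and causal effects\<close>

lemma assignment_of_paths:
  assumes "prob_space M" "i < K" "j < dim_row B" "P \<subseteq> paths G (Shock i) (Var j)"
  shows "\<exists>v \<in> assignments \<xi> j. total_path_effect B \<Omega> \<xi> P = causal_effect M B \<Omega> i e j v"
  using assms(3,4)
proof (induction j arbitrary: P rule: less_induct)
  case (less j)
  let ?R = "\<lambda>k. {p \<in> paths G (Shock i) (Var k). p @ [(Var k, Var j)] \<in> P}"
  have "\<forall>k\<in>{..<j}. \<exists>v. v \<in> assignments \<xi> k \<and>
      total_path_effect B \<Omega> \<xi> (?R k) = causal_effect M B \<Omega> i e k v"
    unfolding Bex_def[symmetric]
    by (intro ballI less.IH) (use less.prems(1) in auto)
  then obtain w where w: "w k \<in> assignments \<xi> k"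
    "total_path_effect B \<Omega> \<xi> (?R k) = causal_effect M B \<Omega> i e k (w k)" if "k < j" for k
    unfolding bchoice_iff by blast
  \<comment> \<open>The subvectors \<open>w k\<close> come from the induction hypothesis for the
    prefixes in \<open>?R k\<close>; the last entry switches the direct arc on or off.\<close>
  obtain v where v: "v \<in> assignments \<xi> j" "\<And>k. k < j \<Longrightarrow> subassignment k v = w k"
    "v ! (2 ^ j - 1) = (if [(Shock i, Var j)] \<in> P then \<xi> else 0)"
    by (rule assignment_of_parts[of j w \<xi> "if [(Shock i, Var j)] \<in> P then \<xi> else 0"])
       (use w(1) in auto)
  have "total_path_effect B \<Omega> \<xi> P = causal_effect M B \<Omega> i e j v"
    unfolding total_path_effect_recursion[OF assms(2) less.prems]
      prob_space.causal_effect_recursion[OF assms(1), of B \<Omega> i e j v] v(3)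
    using w(2) v(2) by simp
  then show ?case
    using v(1) by blast
qed

lemma paths_of_assignment:
  assumes "prob_space M" "i < K" "j < dim_row B" "v \<in> assignments \<xi> j"
  shows "\<exists>P \<subseteq> paths G (Shock i) (Var j). causal_effect M B \<Omega> i e j v = total_path_effect B \<Omega> \<xi> P"
  using assms(3,4)
proof (induction j arbitrary: v rule: less_induct)
  case (less j)
  have "\<exists>P \<subseteq> paths G (Shock i) (Var k).
      causal_effect M B \<Omega> i e k (subassignment k v) = total_path_effect B \<Omega> \<xi> P" if "k < j" for k
    using less.IH[OF that] less.prems that subassignment_in_assignments by simp
  then obtain R where R: "R k \<subseteq> paths G (Shock i) (Var k)"
    "causal_effect M B \<Omega> i e k (subassignment k v) = total_path_effect B \<Omega> \<xi> (R k)"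
    if "k < j" for k
    by metis
  \<comment> \<open>Each path of \<open>R k\<close> is extended by one arc; membership in
    \<open>paths\<close> discards extensions along arcs absent from the graph.\<close>
  define P where "P = {p \<in> paths G (Shock i) (Var j).
    (\<exists>k<j. \<exists>r\<in>R k. p = r @ [(Var k, Var j)]) \<or>
    p = [(Shock i, Var j)] \<and> v ! (2 ^ j - 1) = \<xi>}"
  note iff = snoc_in_paths_iff[OF assms(2) less.prems(1)]
  have P: "P \<subseteq> paths G (Shock i) (Var j)"
    by (auto simp: P_def)
  have "B $$ (j, k) * total_path_effect B \<Omega> \<xi>
        {p \<in> paths G (Shock i) (Var k). p @ [(Var k, Var j)] \<in> P}
      = B $$ (j, k) * causal_effect M B \<Omega> i e k (subassignment k v)" if "k < j" for k
  \<comment> \<open>With a zero coefficient the collected set is empty even when \<open>R k\<close>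
    is not; the factor then makes both sides zero.\<close>
  proof (cases "B $$ (j, k) = 0")
    case False
    then have "{p \<in> paths G (Shock i) (Var k). p @ [(Var k, Var j)] \<in> P} = R k"
      using R(1)[OF that] that by (auto simp: P_def iff)
    then show ?thesis
      using R(2)[OF that] by simp
  qed simp
  \<comment> \<open>If the direct arc is absent, its zero coefficient kills both sides; otherwise a
    last entry other than \<open>\<xi>\<close> must be 0.\<close>
  moreover have "\<Omega> $$ (j, i) * (if [(Shock i, Var j)] \<in> P then \<xi> else 0)
      = \<Omega> $$ (j, i) * v ! (2 ^ j - 1)"
    using assignment_last_in[OF less.prems(2)] iff[of "[]" "(Shock i, Var j)"]
    by (auto simp: P_def)
  ultimately have "causal_effect M B \<Omega> i e j v = total_path_effect B \<Omega> \<xi> P"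
    unfolding total_path_effect_recursion[OF assms(2) less.prems(1) P]
      prob_space.causal_effect_recursion[OF assms(1), of B \<Omega> i e j v]
    by (metis (no_types, lifting) sum.cong lessThan_iff)
  then show ?case
    using P by blast
qed

end

section \<open>Strict lower triangularity of the systems form\<close>

lemma dim_systems_B [simp]: "dim_row (systems_B K l h A T Q L) = (h + 1) * K"
  by (simp add: systems_B_def block_matrix_def)

text \<open>Blocks above the diagonal are zero. In a diagonal block, \<open>inv_diag K L\<close>
  scales the diagonal of the lower-triangular \<open>L\<close> to ones, which the identity matrix
  cancels.\<close>

lemma systems_B_strictly_lower:
  assumes L: "L \<in> carrier_mat K K"
    and upper: "\<And>r c. r < c \<Longrightarrow> c < K \<Longrightarrow> L $$ (r, c) = 0"
    and diag: "\<And>r. r < K \<Longrightarrow> L $$ (r, r) \<noteq> 0"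
    and "n \<le> m" "m < (h + 1) * K"
  shows "systems_B K l h A T Q L $$ (n, m) = 0"
proof -
  have K: "0 < K"
    using assms(5) by (cases K) auto
  have "n div K \<le> m div K"
    using assms(4) by (rule div_le_mono)
  moreover have "(1\<^sub>m K - inv_diag K L * L) $$ (n mod K, m mod K) = 0" if "n div K = m div K"
  proof -
    have "n mod K \<le> m mod K"
      using assms(4) that by (metis div_mult_mod_eq add_le_cancel_left)
    moreover have "n mod K < K" "m mod K < K"
      using K by auto
    ultimately show ?thesis
      using upper[of "n mod K" "m mod K"] diag[of "n mod K"] L
      by (auto simp: inv_diag_def mat_diag_mult_left[OF L])
  qed
  ultimately show ?thesis
    using assms(4,5) K by (auto simp: systems_B_def block_matrix_def)
qed

theorem theorem1:
  fixes M :: "'w measure"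
    and K l q h i j :: nat
    and A \<Psi> :: "nat \<Rightarrow> real mat"
    and y \<epsilon> :: "int \<Rightarrow> 'w \<Rightarrow> real vec"
    and T Q L B \<Omega> :: "real mat"
    and t :: int
    and \<xi> :: real
  assumes varma: "structural_varma M K l q A \<Psi> y \<epsilon>"
    and T: "permutation_matrix K T"
    and QL: "QL_decomposition K (A_star K l A T 0) Q L"
    and B: "B = systems_B K l h A T Q L"
    and Omega: "\<Omega> = systems_Omega K q h \<Psi> Q L"
    and i: "i < K"
    and j: "j < (h + 1) * K"
  shows "(\<forall>P \<subseteq> paths (induced_graph K B \<Omega>) (Shock i) (Var j).
            \<exists>v \<in> assignments \<xi> j.
              total_path_effect B \<Omega> \<xi> P = causal_effect M B \<Omega> i (stacked K h \<epsilon> t) j v)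
       \<and> (\<forall>v \<in> assignments \<xi> j.
            \<exists>P \<subseteq> paths (induced_graph K B \<Omega>) (Shock i) (Var j).
              causal_effect M B \<Omega> i (stacked K h \<epsilon> t) j v = total_path_effect B \<Omega> \<xi> P)"
proof -
  have M: "prob_space M"
    using varma by (rule structural_varma.axioms(1))
  interpret strictly_lower_system K B \<Omega>
  proof
    show "B $$ (n, m) = 0" if "n < dim_row B" "n \<le> m" "m < dim_row B" for n m
      unfolding B using QL that
      by (intro systems_B_strictly_lower) (force simp: QL_decomposition_def B)+
  qed
  have "j < dim_row B"
    using j B by simp
  then show ?thesis
    by (intro conjI allI impI ballI assignment_of_paths[OF M i] paths_of_assignment[OF M i])
qed

end
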